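(* For a real number $R>0$, let $\kappa(R)$ denote the number of unimodular equivalence classes of convex lattice polygons contained in the closed disc $B_R$ of radius $R$ centered at the origin. Then there exist constants $c_1,c_2>0$ and $R_0>0$ such that for all $R\geqslant R_0$, $$c_1R^{2/3}\leqslant \log \kappa(R)\leqslant c_2R^{2/3}.$$
   Context: A convex lattice polygon is the convex hull of a finite subset of $\mathbb{Z}^2$ that is two-dimensional (it may equivalently be identified with the set of its lattice points). $B_R=\{(x,y)\in\mathbb{R}^2: x^2+y^2\leqslant R^2\}$. Two convex lattice polygons $P_1,P_2$ are unimodularly equivalent if there is a $\mathbb{Z}^2$-preserving unimodular transformation $\sigma$ with $\sigma(P_1)=P_2$, i.e. $\sigma(x)=Ax+b$ with $A$ a $2\times 2$ integer matrix of determinant $\pm1$ and $b\in\mathbb{Z}^2$. This is an equivalence relation, and $\kappa(R)$ is the number of equivalence classes that contain at least one convex lattice polygon contained in $B_R$. *)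

theory Defs
  imports "HOL-Analysis.Analysis"
begin

definition lattice_points :: "(real ^ 2) set" where
  "lattice_points = {x. \<forall>i. x $ i \<in> \<int>}"

definition convex_lattice_polygon :: "(real ^ 2) set \<Rightarrow> bool" where
  "convex_lattice_polygon P \<longleftrightarrow>
     (\<exists>S. finite S \<and> S \<subseteq> lattice_points \<and> P = convex hull S) \<and> aff_dim P = 2"

definition unimodular_matrix :: "real ^ 2 ^ 2 \<Rightarrow> bool" where
  "unimodular_matrix A \<longleftrightarrow> (\<forall>i j. A $ i $ j \<in> \<int>) \<and> (det A = 1 \<or> det A = -1)"

definition unimodular_transformation :: "(real ^ 2 \<Rightarrow> real ^ 2) \<Rightarrow> bool" where
  "unimodular_transformation \<sigma> \<longleftrightarrow>
     (\<exists>A b. unimodular_matrix A \<and> b \<in> lattice_points \<and> \<sigma> = (\<lambda>x. A *v x + b))"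

definition unimodular_equivalence :: "((real ^ 2) set \<times> (real ^ 2) set) set" where
  "unimodular_equivalence =
     {(P, Q). convex_lattice_polygon P \<and> convex_lattice_polygon Q \<and>
        (\<exists>\<sigma>. unimodular_transformation \<sigma> \<and> \<sigma> ` P = Q)}"

text \<open>The classes are taken among all convex lattice polygons; those with a representative in the
  closed disc of radius \<open>R\<close> are counted.\<close>

definition kappa :: "real \<Rightarrow> nat" where
  "kappa R =
     card {C \<in> {P. convex_lattice_polygon P} // unimodular_equivalence.
             \<exists>P \<in> C. P \<subseteq> cball 0 R}"

end

theory Submission
  imports Defs "HOL-Real_Asymp.Real_Asymp"
begin

text \<open>
  Upper bound. A polygon is the hull of its extreme points, and each of these is the unique maximiser
  of some linear functional, whose coefficients have one of four sign patterns. After a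
  reflection, the extreme points belonging to one pattern form a staircase whose consecutive
  differences \<open>(a, -b)\<close> have \<open>a, b > 0\<close> and strictly increasing slopes \<open>b / a\<close>. So the staircase is
  determined by its first point and the unordered set of the vectors \<open>(a, b)\<close>, whose entries sum to
  \<open>O(R)\<close>. Weighting a set by \<open>exp (- s (a + b))\<close> per element bounds the number of such sets by
  \<open>exp (O(s R) + 1 / s\<^sup>2)\<close>, and \<open>s = R powr (- 1 / 3)\<close> is the best choice.

  Lower bound. Adding up the coprime pairs from \<open>{1..m}\<^sup>2\<close> in order of increasing slope gives at least
  \<open>m\<^sup>2 / 4\<close> points in strictly convex position within distance \<open>2 m\<^sup>3 \<le> R\<close> of the origin. The subsets
  containing three fixed ones span distinct polygons. An affine map is determined by
  its values on an affine basis, so each equivalence class contains only polynomially many polygons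
  of the disc.
\<close>

section \<open>Strictly exposed lattice points\<close>

definition ivec :: "int \<times> int \<Rightarrow> real ^ 2" where
  "ivec p = vector [of_int (fst p), of_int (snd p)]"

lemma ivec_nth [simp]: "ivec p $ 1 = of_int (fst p)" "ivec p $ 2 = of_int (snd p)"
  by (simp_all add: ivec_def)

lemma inj_ivec: "inj ivec"
  by (rule injI) (metis ivec_nth of_int_eq_iff prod.expand)

lemma range_ivec: "range ivec = lattice_points"
proof
  show "range ivec \<subseteq> lattice_points"
    by (auto simp: lattice_points_def forall_2)
  show "lattice_points \<subseteq> range ivec"
  proof
    fix x :: "real ^ 2" assume "x \<in> lattice_points"
    then obtain i j where "x $ 1 = of_int i" "x $ 2 = of_int j"
      unfolding lattice_points_def Ints_def by blast
    then have "x = ivec (i, j)"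
      by (simp add: vec_eq_iff forall_2)
    then show "x \<in> range ivec" by blast
  qed
qed

lemma inner_ivec: "c \<bullet> ivec p = c $ 1 * of_int (fst p) + c $ 2 * of_int (snd p)"
  by (simp add: inner_vec_def sum_2)

lemma norm_ivec_le: "norm (ivec p) \<le> \<bar>of_int (fst p)\<bar> + \<bar>of_int (snd p)\<bar>"
  using norm_le_l1_cart[of "ivec p"] by (simp add: sum_2)

definition lattice_box :: "int \<Rightarrow> (int \<times> int) set" where
  "lattice_box n = {-n..n} \<times> {-n..n}"

lemma finite_lattice_box [simp]: "finite (lattice_box n)"
  by (simp add: lattice_box_def)

lemma card_lattice_box: "n \<ge> 0 \<Longrightarrow> real (card (lattice_box n)) = (2 * of_int n + 1)\<^sup>2"
  by (simp add: lattice_box_def card_cartesian_product power2_eq_square)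

lemma ivec_in_cball_imp_lattice_box:
  assumes "ivec p \<in> cball 0 R"
  shows "p \<in> lattice_box \<lfloor>R\<rfloor>"
proof -
  have "\<bar>ivec p $ i\<bar> \<le> R" for i
    using component_le_norm_cart[of "ivec p" i] assms by simp
  from this[of 1] this[of 2] show ?thesis
    unfolding lattice_box_def by (cases p) (auto simp: le_floor_iff abs_le_iff minus_le_iff; linarith)
qed

text \<open>The set where \<open>c\<close> stays below \<open>c \<bullet> x\<close> is convex and
  contains \<open>S\<close>, hence contains the hull, but it misses \<open>x\<close>.\<close>

lemma exposed_imp_not_in_convex_hull:
  assumes "\<And>y. y \<in> S \<Longrightarrow> c \<bullet> y < c \<bullet> x"
  shows "x \<notin> convex hull S"
proof -
  have "convex hull S \<subseteq> {y. c \<bullet> y < c \<bullet> x}"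
    by (rule hull_minimal) (use assms convex_halfspace_lt in auto)
  then show ?thesis by auto
qed

text \<open>\<open>E\<close> consists of the extreme points: Krein-Milman recovers \<open>P\<close>
  from them, and strict separation of each from the hull of the others supplies the
  functional.\<close>

lemma lattice_polygon_extreme_points:
  assumes "convex_lattice_polygon P" "P \<subseteq> cball 0 R"
  obtains E where "E \<subseteq> lattice_box \<lfloor>R\<rfloor>" "P = convex hull (ivec ` E)"
    "\<And>p. p \<in> E \<Longrightarrow> \<exists>c. \<forall>q\<in>E. q \<noteq> p \<longrightarrow> c \<bullet> ivec q < c \<bullet> ivec p"
proof -
  obtain S where S: "finite S" "S \<subseteq> lattice_points" "P = convex hull S"
    using assms unfolding convex_lattice_polygon_def by blast
  define X where "X = {x. x extreme_point_of P}"
  have XS: "X \<subseteq> S"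
    unfolding X_def S(3) using extreme_point_of_convex_hull by blast
  have XP: "X \<subseteq> P"
    unfolding X_def by (auto simp: extreme_point_of_def)
  have hull: "P = convex hull X"
    unfolding X_def using S Krein_Milman_polytope by auto
  define E where "E = ivec -` X"
  have XE: "X = ivec ` E"
    unfolding E_def using XS S(2) range_ivec by auto
  show ?thesis
  proof
    show "E \<subseteq> lattice_box \<lfloor>R\<rfloor>"
      using ivec_in_cball_imp_lattice_box XP assms(2) unfolding E_def by blast
    show "P = convex hull (ivec ` E)"
      using hull XE by simp
    fix p assume p: "p \<in> E"
    define H where "H = convex hull (X - {ivec p})"
    have "ivec p \<notin> H"
    proof
      assume "ivec p \<in> H"
      moreover have "H \<subseteq> P - {ivec p}"
      proof -
        \<comment> \<open>Removing an extreme point from a convex set keeps it convex, so the hull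
          of the other extreme points cannot reach it.\<close>
        have "convex (P - {ivec p})"
          using p hull convex_convex_hull[of X] extreme_point_of_stillconvex[of P "ivec p"]
          unfolding E_def X_def by simp
        then show ?thesis
          unfolding H_def using XP by (intro hull_minimal) auto
      qed
      ultimately show False by blast
    qed
    moreover have "closed H" "convex H"
      unfolding H_def using finite_subset[OF XS S(1)]
      by (auto intro!: compact_imp_closed finite_imp_compact_convex_hull)
    ultimately obtain a b where "a \<bullet> ivec p < b" "\<forall>x\<in>H. a \<bullet> x > b"
      using separating_hyperplane_closed_point[of H "ivec p"] by blast
    \<comment> \<open>Separation puts the point on the low side; negating the functional makes it
      the strict maximiser.\<close>
    then have "\<forall>q\<in>E. q \<noteq> p \<longrightarrow> (-a) \<bullet> ivec q < (-a) \<bullet> ivec p"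
      unfolding H_def XE using inj_ivec hull_subset[of "ivec ` E - {ivec p}" convex]
      by (smt (verit, best) Diff_iff imageI inj_eq inner_minus_left singletonD subsetD)
    then show "\<exists>c. \<forall>q\<in>E. q \<noteq> p \<longrightarrow> c \<bullet> ivec q < c \<bullet> ivec p" by blast
  qed
qed

section \<open>Staircases and the number of polygons in a disc\<close>

text \<open>One of the four sign patterns, normalised to nonnegative coefficients: such points form
  the upper right part of a boundary.\<close>

definition quadrant_exposed :: "(int \<times> int) set \<Rightarrow> bool" where
  "quadrant_exposed W \<longleftrightarrow> (\<forall>p\<in>W. \<exists>\<alpha> \<beta> :: real. \<alpha> \<ge> 0 \<and> \<beta> \<ge> 0 \<and>
     (\<forall>q\<in>W. q \<noteq> p \<longrightarrow> \<alpha> * of_int (fst q) + \<beta> * of_int (snd q)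
                      < \<alpha> * of_int (fst p) + \<beta> * of_int (snd p)))"

text \<open>The second entry of a difference records a drop, so a descending chain is encoded by
  vectors of the positive quadrant.\<close>

fun staircase :: "int \<times> int \<Rightarrow> (int \<times> int) list \<Rightarrow> (int \<times> int) list" where
  "staircase p [] = [p]"
| "staircase p (d # ds) = p # staircase (fst p + fst d, snd p - snd d) ds"

definition slope :: "int \<times> int \<Rightarrow> real" where
  "slope d = of_int (snd d) / of_int (fst d)"

lemma start_in_staircase: "p \<in> set (staircase p ds)"
  by (cases ds) auto

lemma end_in_staircase: "(fst p + (\<Sum>d\<leftarrow>ds. fst d), snd p - (\<Sum>d\<leftarrow>ds. snd d)) \<in> set (staircase p ds)"
proof (induction ds arbitrary: p)
  case (Cons d ds)
  from Cons[of "(fst p + fst d, snd p - snd d)"] show ?case by (simp add: algebra_simps)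
qed simp

lemma quadrant_exposed_subset: "quadrant_exposed W \<Longrightarrow> W' \<subseteq> W \<Longrightarrow> quadrant_exposed W'"
  unfolding quadrant_exposed_def by (meson subsetD)

text \<open>A point dominated in both coordinates by another point of \<open>W\<close> cannot
  strictly beat it under nonnegative coefficients.\<close>

lemma quadrant_exposed_antitone:
  assumes "quadrant_exposed W" "p \<in> W" "q \<in> W" "p \<noteq> q" "fst p \<le> fst q"
  shows "fst p < fst q" "snd q < snd p"
proof -
  have *: False if uv: "u \<in> W" "v \<in> W" "u \<noteq> v" "fst u \<le> fst v" "snd u \<le> snd v" for u v
  proof -
    obtain \<alpha> \<beta> :: real where "\<alpha> \<ge> 0" "\<beta> \<ge> 0"
      "\<alpha> * of_int (fst v) + \<beta> * of_int (snd v) < \<alpha> * of_int (fst u) + \<beta> * of_int (snd u)"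
      using assms(1) uv(1,2,3) unfolding quadrant_exposed_def by metis
    moreover have "\<alpha> * of_int (fst u) \<le> \<alpha> * of_int (fst v)" "\<beta> * of_int (snd u) \<le> \<beta> * of_int (snd v)"
      using uv \<open>\<alpha> \<ge> 0\<close> \<open>\<beta> \<ge> 0\<close> by (auto intro!: mult_left_mono)
    ultimately show False by linarith
  qed
  show "snd q < snd p" using *[of p q] assms by force
  show "fst p < fst q" using *[of q p] \<open>snd q < snd p\<close> assms by force
qed

text \<open>Induction peels off the leftmost point. Slopes increase because the functional exposing
  the next point prefers it to both of its neighbours.\<close>

lemma quadrant_exposed_staircase:
  assumes "finite W" "W \<noteq> {}" "quadrant_exposed W"
  shows "\<exists>p ds. set (staircase p ds) = W \<and> (\<forall>q\<in>W. fst p \<le> fst q) \<and>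
           (\<forall>d\<in>set ds. fst d > 0 \<and> snd d > 0) \<and> sorted_wrt (<) (map slope ds)"
  using assms
proof (induction "card W" arbitrary: W)
  case 0
  then show ?case by simp
next
  case (Suc k)
  obtain p where p: "p \<in> W" "\<And>q. q \<in> W \<Longrightarrow> fst p \<le> fst q"
    using ex_min_if_finite[of "fst ` W"] Suc.prems by (metis arg_min_if_finite(1) arg_min_least)
  define W' where "W' = W - {p}"
  show ?case
  proof (cases "W' = {}")
    case True
    then have "W = {p}" using p W'_def by blast
    then show ?thesis by (intro exI[of _ p] exI[of _ "[]"]) simp
  next
    case False
    have "k = card W'" "finite W'"
      using Suc.hyps(2) p(1) Suc.prems(1) unfolding W'_def by auto
    moreover have "quadrant_exposed W'"
      using Suc.prems(3) W'_def quadrant_exposed_subset by blast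
    ultimately obtain p' ds where IH: "set (staircase p' ds) = W'" "\<forall>q\<in>W'. fst p' \<le> fst q"
      "\<forall>d\<in>set ds. fst d > 0 \<and> snd d > 0" "sorted_wrt (<) (map slope ds)"
      using Suc.hyps(1)[of W'] False by blast
    have p': "p' \<in> W'" using IH(1) start_in_staircase by blast
    define d where "d = (fst p' - fst p, snd p - snd p')"
    have dpos: "fst d > 0" "snd d > 0"
      using quadrant_exposed_antitone[OF Suc.prems(3), of p p'] p p' unfolding d_def W'_def by auto
    have "\<forall>e\<in>set ds. slope d < slope e"
    proof (cases ds)
      case (Cons e es)
      define p'' where "p'' = (fst p' + fst e, snd p' - snd e)"
      have epos: "fst e > 0" "snd e > 0" using IH(3) Cons by auto
      have "p'' \<in> W'" using IH(1) Cons start_in_staircase[of p'' es] unfolding p''_def by auto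
      \<comment> \<open>Expose the middle one of \<open>p\<close>, \<open>p'\<close>,
        \<open>p''\<close>: beating the other two places \<open>\<alpha> / \<beta>\<close> strictly
        between the slopes of \<open>d\<close> and \<open>e\<close>.\<close>
      obtain \<alpha> \<beta> :: real where ab: "\<alpha> \<ge> 0" "\<beta> \<ge> 0"
        "\<And>q. q\<in>W \<Longrightarrow> q \<noteq> p' \<Longrightarrow> \<alpha> * of_int (fst q) + \<beta> * of_int (snd q)
                      < \<alpha> * of_int (fst p') + \<beta> * of_int (snd p')"
        using Suc.prems(3) p' unfolding quadrant_exposed_def W'_def by blast
      have "\<alpha> * of_int (fst p) + \<beta> * of_int (snd p) < \<alpha> * of_int (fst p') + \<beta> * of_int (snd p')"
        using ab(3) p(1) p' unfolding W'_def by blast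
      then have 1: "\<beta> * of_int (snd d) < \<alpha> * of_int (fst d)"
        unfolding d_def by (simp add: algebra_simps)
      have "p'' \<noteq> p'" using epos unfolding p''_def by (cases p') auto
      then have "\<alpha> * of_int (fst p'') + \<beta> * of_int (snd p'') < \<alpha> * of_int (fst p') + \<beta> * of_int (snd p')"
        using ab(3) \<open>p'' \<in> W'\<close> unfolding W'_def by blast
      then have 2: "\<alpha> * of_int (fst e) < \<beta> * of_int (snd e)"
        unfolding p''_def by (simp add: algebra_simps)
      have "0 \<le> \<alpha> * of_int (fst e)" using ab epos by simp
      then have "0 < \<beta> * of_int (snd e)" using 2 by linarith
      then have "\<beta> > 0" using epos ab(2) by (metis less_eq_real_def mult_zero_left less_irrefl)
      have "slope d < \<alpha> / \<beta>" "\<alpha> / \<beta> < slope e"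
        using 1 2 \<open>\<beta> > 0\<close> dpos epos by (simp_all add: slope_def field_simps)
      then have "slope d < slope e" by linarith
      then show ?thesis using IH(4) Cons by force
    qed simp
    then have "sorted_wrt (<) (map slope (d # ds))" using IH(4) by simp
    moreover have "set (staircase p (d # ds)) = W"
      using IH(1) p(1) unfolding d_def W'_def by auto
    ultimately show ?thesis using p(2) IH(3) dpos
      by (intro exI[of _ p] exI[of _ "d # ds"]) auto
  qed
qed

text \<open>Strictly increasing slopes are distinct, so a set of differences has only one such
  arrangement; hence counting unordered sets suffices.\<close>

lemma slope_sorted_list_unique:
  assumes "set xs = set ys" "sorted_wrt (<) (map slope xs)" "sorted_wrt (<) (map slope ys)"
  shows "xs = ys"
proof -
  have eq: "map slope xs = map slope ys"
    using assms by (intro strict_sorted_equal) auto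
  have "inj_on slope (set xs)"
    using assms(2) distinct_map strict_sorted_iff by blast
  then show ?thesis using eq assms(1) by (simp add: inj_on_map_eq_map)
qed

section \<open>Counting sets of difference vectors by exponential weights\<close>

definition difference_sets :: "int \<Rightarrow> (int \<times> int) set set" where
  "difference_sets n = {D. D \<subseteq> {1..n} \<times> {1..n} \<and> (\<Sum>d\<in>D. fst d + snd d) \<le> n}"

lemma finite_difference_sets [simp]: "finite (difference_sets n)"
  by (rule finite_subset[of _ "Pow ({1..n} \<times> {1..n})"]) (auto simp: difference_sets_def)

lemma sum_exp_le:
  fixes s :: real
  assumes "s > 0"
  shows "(\<Sum>k\<in>{1..n::int}. exp (- s * of_int k)) \<le> 1 / s"
proof -
  \<comment> \<open>Keeping the remainder \<open>exp (- s * of_nat m)\<close> makes the bound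
    telescope, with \<open>1 + s \<le> exp s\<close> driving each step.\<close>
  have *: "s * (\<Sum>k\<in>{1..m}. exp (- s * of_nat k)) \<le> 1 - exp (- s * of_nat m)" for m :: nat
  proof (induction m)
    case (Suc m)
    have "exp (- s * of_nat (Suc m)) * (1 + s) \<le> exp (- s * of_nat (Suc m)) * exp s"
      by (intro mult_left_mono) (use exp_ge_add_one_self[of s] in simp_all)
    also have "\<dots> = exp (- s * of_nat m)"
      by (simp flip: exp_add add: algebra_simps)
    finally show ?case using Suc by (simp add: algebra_simps)
  qed simp
  have "{1..n} = int ` {1..nat n}"
    by (auto simp: image_int_atLeastAtMost)
  then have "(\<Sum>k\<in>{1..n}. exp (- s * of_int k)) = (\<Sum>k\<in>{1..nat n}. exp (- s * of_nat k))"
    by (simp add: sum.reindex)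
  also have "\<dots> \<le> 1 / s"
    using *[of "nat n"] assms by (simp add: field_simps) (smt (verit) exp_ge_zero)
  finally show ?thesis .
qed

text \<open>Expanding the product means choosing \<open>1\<close> or \<open>f d\<close> from each
  factor; \<open>D\<close> records where \<open>f d\<close> was chosen.\<close>

lemma sum_Pow_prod:
  fixes f :: "'a \<Rightarrow> real"
  assumes "finite A"
  shows "(\<Sum>D\<in>Pow A. \<Prod>d\<in>D. f d) = (\<Prod>d\<in>A. 1 + f d)"
  using prod_add[OF assms, of f "\<lambda>_. 1"] by (simp add: add.commute)

text \<open>Rankin's trick: scaled by \<open>exp (s * of_int n)\<close>, every admissible set has
  weight at least \<open>1\<close>, and the weights of all subsets add up to a product.\<close>

lemma card_difference_sets_le:
  assumes "s > 0"
  shows "real (card (difference_sets n)) \<le> exp (s * of_int n + 1 / s\<^sup>2)"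
proof -
  define A where "A = {1..n} \<times> {1..n}"
  define w :: "int \<times> int \<Rightarrow> real" where "w = (\<lambda>d. exp (- s * of_int (fst d + snd d)))"
  have "real (card (difference_sets n)) = (\<Sum>D\<in>difference_sets n. 1)" by simp
  also have "\<dots> \<le> (\<Sum>D\<in>difference_sets n. exp (s * of_int n) * (\<Prod>d\<in>D. w d))"
  proof (rule sum_mono)
    fix D assume D: "D \<in> difference_sets n"
    then have "finite D" unfolding difference_sets_def using finite_subset by fastforce
    then have "(\<Prod>d\<in>D. w d) = exp (- s * of_int (\<Sum>d\<in>D. fst d + snd d))"
      unfolding w_def by (simp add: sum_distrib_left flip: exp_sum)
    then have "exp (s * of_int n) * (\<Prod>d\<in>D. w d) = exp (s * (of_int (n - (\<Sum>d\<in>D. fst d + snd d))))"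
      by (simp add: algebra_simps flip: exp_add)
    moreover have "s * (of_int (n - (\<Sum>d\<in>D. fst d + snd d))) \<ge> 0"
      using D assms unfolding difference_sets_def
      by (intro mult_nonneg_nonneg) (auto simp del: of_int_sum of_int_diff)
    ultimately show "1 \<le> exp (s * of_int n) * (\<Prod>d\<in>D. w d)" by simp
  qed
  \<comment> \<open>The limit on the total is dropped here, so that the sum factorises.\<close>
  also have "\<dots> \<le> (\<Sum>D\<in>Pow A. exp (s * of_int n) * (\<Prod>d\<in>D. w d))"
    by (rule sum_mono2) (auto simp: A_def difference_sets_def w_def intro!: mult_nonneg_nonneg prod_nonneg)
  also have "\<dots> = exp (s * of_int n) * (\<Prod>d\<in>A. 1 + w d)"
    by (simp add: sum_distrib_left[symmetric] sum_Pow_prod A_def)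
  also have "(\<Prod>d\<in>A. 1 + w d) \<le> (\<Prod>d\<in>A. exp (w d))"
    by (intro prod_mono) (auto simp: w_def add_nonneg_nonneg)
  also have "\<dots> = exp (\<Sum>d\<in>A. w d)"
    by (simp add: A_def exp_sum)
  \<comment> \<open>The weight of a pair is a product over its coordinates, so the double sum is a
    square.\<close>
  also have "(\<Sum>d\<in>A. w d) = (\<Sum>k\<in>{1..n}. exp (- s * of_int k))\<^sup>2"
    unfolding A_def w_def power2_eq_square sum_product sum.cartesian_product
    by (intro sum.cong) (auto simp: algebra_simps simp flip: exp_add)
  also have "\<dots> \<le> (1 / s)\<^sup>2"
    by (intro power_mono sum_exp_le assms sum_nonneg) auto
  finally show ?thesis by (simp add: exp_add power_divide mult_left_mono)
qed

text \<open>The first and last points lie in the box, so the total run and the total drop are at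
  most \<open>2 * n\<close> each.\<close>

lemma staircase_total:
  assumes "set (staircase p ds) \<subseteq> lattice_box n"
  shows "(\<Sum>d\<leftarrow>ds. fst d + snd d) \<le> 4 * n"
proof -
  have "p \<in> lattice_box n" "(fst p + (\<Sum>d\<leftarrow>ds. fst d), snd p - (\<Sum>d\<leftarrow>ds. snd d)) \<in> lattice_box n"
    using assms start_in_staircase end_in_staircase by blast+
  then show ?thesis
    unfolding lattice_box_def by (auto simp: sum_list_addf)
qed

definition exposed_sets :: "int \<Rightarrow> (int \<times> int) set set" where
  "exposed_sets n = {W. W \<subseteq> lattice_box n \<and> quadrant_exposed W}"

lemma finite_exposed_sets [simp]: "finite (exposed_sets n)"
  by (rule finite_subset[of _ "Pow (lattice_box n)"]) (auto simp: exposed_sets_def)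

text \<open>A nonempty exposed set is coded by its starting point and its set of differences; the
  summand \<open>1\<close> accounts for the empty set, which is no staircase.\<close>

lemma card_exposed_sets_le:
  assumes "n \<ge> 0" "s > 0"
  shows "real (card (exposed_sets n)) \<le> 1 + (2 * of_int n + 1)\<^sup>2 * exp (4 * s * of_int n + 1 / s\<^sup>2)"
proof -
  define decode where
    "decode = (\<lambda>(p, D). set (staircase p (SOME ds. set ds = D \<and> sorted_wrt (<) (map slope ds))))"
  have "exposed_sets n \<subseteq> insert {} (decode ` (lattice_box n \<times> difference_sets (4 * n)))"
  proof
    fix W assume W: "W \<in> exposed_sets n"
    show "W \<in> insert {} (decode ` (lattice_box n \<times> difference_sets (4 * n)))"
    proof (cases "W = {}")
      case False
      have Wb: "W \<subseteq> lattice_box n" "quadrant_exposed W"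
        using W unfolding exposed_sets_def by auto
      obtain p ds where ds: "set (staircase p ds) = W" "\<forall>d\<in>set ds. fst d > 0 \<and> snd d > 0"
        "sorted_wrt (<) (map slope ds)"
        using quadrant_exposed_staircase[of W] False Wb finite_subset[OF Wb(1)] by auto
      have p: "p \<in> lattice_box n" using start_in_staircase[of p ds] ds(1) Wb by auto
      have "distinct ds"
        using ds(3) by (metis distinct_map strict_sorted_iff)
      then have tot: "(\<Sum>d\<in>set ds. fst d + snd d) \<le> 4 * n"
        using staircase_total[of p ds n] ds(1) Wb by (simp add: sum_list_distinct_conv_sum_set)
      have "d \<in> {1..4*n} \<times> {1..4*n}" if "d \<in> set ds" for d
      proof -
        have "fst d + snd d \<le> (\<Sum>d\<in>set ds. fst d + snd d)"
          by (rule member_le_sum) (use that ds(2) in force)+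
        then show ?thesis using tot ds(2) that by (cases d) fastforce
      qed
      then have D: "set ds \<in> difference_sets (4 * n)"
        using tot unfolding difference_sets_def by blast
      have "(SOME es. set es = set ds \<and> sorted_wrt (<) (map slope es)) = ds"
        using ds(3) slope_sorted_list_unique by (intro some_equality) blast+
      then have "decode (p, set ds) = W" using ds(1) by (simp add: decode_def)
      then show ?thesis using p D by force
    qed simp
  qed
  then have "card (exposed_sets n) \<le> card (insert {} (decode ` (lattice_box n \<times> difference_sets (4 * n))))"
    by (intro card_mono) auto
  also have "\<dots> \<le> Suc (card (decode ` (lattice_box n \<times> difference_sets (4 * n))))"
    by (intro card_insert_le_m1) auto
  also have "\<dots> \<le> Suc (card (lattice_box n \<times> difference_sets (4 * n)))"
    by (intro Suc_le_mono[THEN iffD2] card_image_le) simp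
  finally have "real (card (exposed_sets n)) \<le> 1 + real (card (lattice_box n)) * real (card (difference_sets (4 * n)))"
    by (simp add: card_cartesian_product flip: of_nat_mult)
  also have "\<dots> \<le> 1 + (2 * of_int n + 1)\<^sup>2 * exp (4 * s * of_int n + 1 / s\<^sup>2)"
    unfolding card_lattice_box[OF assms(1)]
    using card_difference_sets_le[OF assms(2), of "4 * n"]
    by (intro add_left_mono mult_left_mono) (auto simp: mult_ac)
  finally show ?thesis .
qed

section \<open>Splitting vertex sets into four reflected staircases\<close>

definition polygons_in_disc :: "real \<Rightarrow> (real ^ 2) set set" where
  "polygons_in_disc R = {P. convex_lattice_polygon P \<and> P \<subseteq> cball 0 R}"

definition signs :: "(int \<times> int) set" where
  "signs = {1, -1} \<times> {1, -1}"

definition reflect :: "int \<times> int \<Rightarrow> int \<times> int \<Rightarrow> int \<times> int" where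
  "reflect s p = (fst s * fst p, snd s * snd p)"

lemma finite_signs [simp]: "finite signs" and card_signs: "card signs = 4"
  by (simp_all add: signs_def card_cartesian_product)

lemma reflect_reflect: "s \<in> signs \<Longrightarrow> reflect s (reflect s p) = p"
  by (auto simp: signs_def reflect_def)

lemma reflect_in_lattice_box: "s \<in> signs \<Longrightarrow> p \<in> lattice_box n \<Longrightarrow> reflect s p \<in> lattice_box n"
  by (auto simp: signs_def reflect_def lattice_box_def)

text \<open>Every vertex is exposed by a functional of some sign pattern. The four pieces may
  overlap, since only their union enters the hull.\<close>

lemma polygons_in_disc_subset:
  "polygons_in_disc R \<subseteq> (\<lambda>F. convex hull (ivec ` (\<Union>s\<in>signs. reflect s ` F s))) `
     (signs \<rightarrow>\<^sub>E exposed_sets \<lfloor>R\<rfloor>)"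
proof
  fix P assume "P \<in> polygons_in_disc R"
  then obtain E where E: "E \<subseteq> lattice_box \<lfloor>R\<rfloor>" "P = convex hull (ivec ` E)"
    "\<And>p. p \<in> E \<Longrightarrow> \<exists>c. \<forall>q\<in>E. q \<noteq> p \<longrightarrow> c \<bullet> ivec q < c \<bullet> ivec p"
    unfolding polygons_in_disc_def using lattice_polygon_extreme_points[of P R] by blast
  define X where "X = (\<lambda>s. {p\<in>E. \<exists>c. 0 \<le> c $ 1 * of_int (fst s) \<and> 0 \<le> c $ 2 * of_int (snd s) \<and>
    (\<forall>q\<in>E. q \<noteq> p \<longrightarrow> c \<bullet> ivec q < c \<bullet> ivec p)})"
  define F where "F = (\<lambda>s\<in>signs. reflect s ` X s)"
  have cover: "(\<Union>s\<in>signs. X s) = E"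
  proof
    show "E \<subseteq> (\<Union>s\<in>signs. X s)"
    proof
      fix p assume p: "p \<in> E"
      then obtain c where c: "\<forall>q\<in>E. q \<noteq> p \<longrightarrow> c \<bullet> ivec q < c \<bullet> ivec p"
        using E(3) by blast
      \<comment> \<open>A vanishing coefficient is compatible with both signs and is given the sign
        \<open>1\<close>.\<close>
      define s :: "int \<times> int" where
        "s = (if c $ 1 \<ge> 0 then 1 else -1, if c $ 2 \<ge> 0 then 1 else -1)"
      have "s \<in> signs" by (auto simp: s_def signs_def)
      moreover have "p \<in> X s"
        unfolding X_def using p c by (auto simp: s_def intro!: exI[of _ c])
      ultimately show "p \<in> (\<Union>s\<in>signs. X s)" by blast
    qed
  qed (auto simp: X_def)
  have "(\<Union>s\<in>signs. reflect s ` F s) = E"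
    unfolding cover[symmetric] F_def by (auto simp: image_image reflect_reflect)
  moreover have "F \<in> signs \<rightarrow>\<^sub>E exposed_sets \<lfloor>R\<rfloor>"
  proof
    fix s assume s: "s \<in> signs"
    have "F s \<subseteq> lattice_box \<lfloor>R\<rfloor>"
      using E(1) reflect_in_lattice_box[OF s] s unfolding F_def X_def by auto
    moreover have "quadrant_exposed (F s)"
      unfolding quadrant_exposed_def
    proof
      fix p' assume "p' \<in> F s"
      then obtain p where p: "p \<in> X s" "p' = reflect s p" using s unfolding F_def by auto
      then obtain c where c: "0 \<le> c $ 1 * of_int (fst s)" "0 \<le> c $ 2 * of_int (snd s)"
        "\<And>q. q \<in> E \<Longrightarrow> q \<noteq> p \<Longrightarrow> c \<bullet> ivec q < c \<bullet> ivec p"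
        unfolding X_def by blast
      \<comment> \<open>Reflecting the point and the coefficients together preserves the inner
        product, since signs square to \<open>1\<close>.\<close>
      have dot: "c $ 1 * of_int (fst s) * of_int (fst (reflect s q)) +
          c $ 2 * of_int (snd s) * of_int (snd (reflect s q)) = c \<bullet> ivec q" for q
        using s by (auto simp: signs_def reflect_def inner_ivec)
      show "\<exists>\<alpha> \<beta> :: real. \<alpha> \<ge> 0 \<and> \<beta> \<ge> 0 \<and>
        (\<forall>q\<in>F s. q \<noteq> p' \<longrightarrow> \<alpha> * of_int (fst q) + \<beta> * of_int (snd q)
                      < \<alpha> * of_int (fst p') + \<beta> * of_int (snd p'))"
      proof (intro exI conjI ballI impI)
        fix q' assume "q' \<in> F s" "q' \<noteq> p'"
        then obtain q where "q \<in> E" "q' = reflect s q" "q \<noteq> p"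
          using s p(2) unfolding F_def X_def by auto
        then show "c $ 1 * of_int (fst s) * of_int (fst q') + c $ 2 * of_int (snd s) * of_int (snd q') <
          c $ 1 * of_int (fst s) * of_int (fst p') + c $ 2 * of_int (snd s) * of_int (snd p')"
          unfolding p(2) using c(3) dot by metis
      qed (use c in auto)
    qed
    ultimately show "F s \<in> exposed_sets \<lfloor>R\<rfloor>" unfolding exposed_sets_def by blast
  qed (simp add: F_def)
  ultimately show "P \<in> (\<lambda>F. convex hull (ivec ` (\<Union>s\<in>signs. reflect s ` F s))) `
     (signs \<rightarrow>\<^sub>E exposed_sets \<lfloor>R\<rfloor>)"
    using E(2) by (intro image_eqI[of _ _ F]) auto
qed

lemma finite_polygons_in_disc [simp]: "finite (polygons_in_disc R)"
  using polygons_in_disc_subset by (rule finite_subset) (auto intro!: finite_PiE)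

lemma card_polygons_in_disc_le: "card (polygons_in_disc R) \<le> card (exposed_sets \<lfloor>R\<rfloor>) ^ 4"
proof -
  have "card (polygons_in_disc R) \<le> card (signs \<rightarrow>\<^sub>E exposed_sets \<lfloor>R\<rfloor>)"
    using polygons_in_disc_subset by (rule surj_card_le[rotated]) (auto intro!: finite_PiE)
  then show ?thesis by (simp add: card_funcsetE card_signs)
qed

section \<open>Unimodular equivalence\<close>

lemma unimodular_transformation_id: "unimodular_transformation (\<lambda>x. x)"
proof -
  have "unimodular_matrix (mat 1)" "0 \<in> lattice_points"
    by (simp_all add: unimodular_matrix_def lattice_points_def) (simp add: mat_def)
  moreover have "(\<lambda>x. x) = (\<lambda>x. mat 1 *v x + 0 :: real ^ 2)" by simp
  ultimately show ?thesis unfolding unimodular_transformation_def by blast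
qed

lemma lattice_points_matrix:
  assumes "unimodular_matrix A" "b \<in> lattice_points"
  shows "A *v b \<in> lattice_points"
  using assms unfolding unimodular_matrix_def lattice_points_def matrix_vector_mult_def
  by (auto simp: sum_2)

lemma unimodular_transformation_comp:
  assumes "unimodular_transformation \<sigma>" "unimodular_transformation \<tau>"
  shows "unimodular_transformation (\<lambda>x. \<sigma> (\<tau> x))"
proof -
  obtain A b where A: "unimodular_matrix A" "b \<in> lattice_points" "\<sigma> = (\<lambda>x. A *v x + b)"
    using assms unfolding unimodular_transformation_def by blast
  obtain B c where B: "unimodular_matrix B" "c \<in> lattice_points" "\<tau> = (\<lambda>x. B *v x + c)"
    using assms unfolding unimodular_transformation_def by blast
  have "det (A ** B) = 1 \<or> det (A ** B) = -1"
    using A(1) B(1) unfolding unimodular_matrix_def det_mul by auto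
  moreover have "(A ** B) $ i $ j \<in> \<int>" for i j
    using A(1) B(1) unfolding unimodular_matrix_def by (simp add: matrix_matrix_mult_def sum_2)
  ultimately have "unimodular_matrix (A ** B)"
    unfolding unimodular_matrix_def by blast
  moreover have "A *v c + b \<in> lattice_points"
    using lattice_points_matrix[OF A(1) B(2)] A(2) by (simp add: lattice_points_def)
  moreover have "(\<lambda>x. \<sigma> (\<tau> x)) = (\<lambda>x. (A ** B) *v x + (A *v c + b))"
    unfolding A(3) B(3) by (simp add: matrix_vector_right_distrib matrix_vector_mul_assoc add.assoc)
  ultimately show ?thesis unfolding unimodular_transformation_def by blast
qed

lemma unimodular_transformation_inverse:
  assumes "unimodular_transformation \<sigma>"
  obtains \<tau> where "unimodular_transformation \<tau>" "\<And>x. \<tau> (\<sigma> x) = x"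
proof -
  obtain A b where A: "unimodular_matrix A" "b \<in> lattice_points" "\<sigma> = (\<lambda>x. A *v x + b)"
    using assms unfolding unimodular_transformation_def by blast
  \<comment> \<open>The adjugate times \<open>det A\<close>: this is the inverse because
    \<open>det A\<close> is its own reciprocal, and its entries are visibly integers.\<close>
  define B :: "real ^ 2 ^ 2" where
    "B = vector [vector [det A * A $ 2 $ 2, - det A * A $ 1 $ 2],
                 vector [- det A * A $ 2 $ 1, det A * A $ 1 $ 1]]"
  have d: "det A = 1 \<or> det A = -1" "A $ i $ j \<in> \<int>" for i j
    using A(1) unfolding unimodular_matrix_def by auto
  have dd: "det A * det A = 1" using d(1) by auto
  have "det B = 1 \<or> det B = -1"
  proof -
    have "det B = det A * det A * det A"
      unfolding B_def det_2 by (simp add: algebra_simps)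
    then show ?thesis using d(1) by auto
  qed
  then have B: "unimodular_matrix B"
    using d unfolding unimodular_matrix_def B_def by (auto simp: forall_2)
  have "B ** A = (\<chi> i j. if i = j then det A * det A else 0)"
    unfolding det_2[of A] B_def
    by (simp add: vec_eq_iff forall_2 matrix_matrix_mult_def sum_2 det_2 algebra_simps)
  then have BA: "B ** A = mat 1" unfolding dd mat_def .
  have "- (B *v b) \<in> lattice_points"
    using lattice_points_matrix[OF B A(2)] by (simp add: lattice_points_def)
  then have "unimodular_transformation (\<lambda>y. B *v y + - (B *v b))"
    using B unfolding unimodular_transformation_def by blast
  moreover have "B *v (\<sigma> x) + - (B *v b) = x" for x
    unfolding A(3) by (simp add: matrix_vector_right_distrib matrix_vector_mul_assoc BA)
  ultimately show ?thesis using that by blast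
qed

lemma equiv_unimodular_equivalence:
  "equiv {P. convex_lattice_polygon P} unimodular_equivalence"
proof (rule equivI)
  show "refl_on {P. convex_lattice_polygon P} unimodular_equivalence"
    unfolding refl_on_def unimodular_equivalence_def
    using unimodular_transformation_id by (auto intro!: exI[of _ "\<lambda>x. x"])
  show "unimodular_equivalence \<subseteq> {P. convex_lattice_polygon P} \<times> {P. convex_lattice_polygon P}"
    unfolding unimodular_equivalence_def by blast
  show "sym unimodular_equivalence"
  proof (rule symI)
    fix P Q assume PQ: "(P, Q) \<in> unimodular_equivalence"
    then obtain \<sigma> where \<sigma>: "unimodular_transformation \<sigma>" "\<sigma> ` P = Q"
      unfolding unimodular_equivalence_def by blast
    obtain \<tau> where \<tau>: "unimodular_transformation \<tau>" "\<And>x. \<tau> (\<sigma> x) = x"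
      using unimodular_transformation_inverse[OF \<sigma>(1)] by blast
    have "\<tau> ` Q = P" unfolding \<sigma>(2)[symmetric] by (simp add: image_image \<tau>(2))
    then show "(Q, P) \<in> unimodular_equivalence"
      using PQ \<tau>(1) unfolding unimodular_equivalence_def by auto
  qed
  show "trans unimodular_equivalence"
  proof (rule transI)
    fix P Q T assume *: "(P, Q) \<in> unimodular_equivalence" "(Q, T) \<in> unimodular_equivalence"
    then obtain \<sigma> \<tau> where "unimodular_transformation \<sigma>" "\<sigma> ` P = Q"
      "unimodular_transformation \<tau>" "\<tau> ` Q = T"
      unfolding unimodular_equivalence_def by blast
    then have "unimodular_transformation (\<lambda>x. \<tau> (\<sigma> x))" "(\<lambda>x. \<tau> (\<sigma> x)) ` P = T"
      by (auto intro: unimodular_transformation_comp)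
    then show "(P, T) \<in> unimodular_equivalence"
      using * unfolding unimodular_equivalence_def by auto
  qed
qed

lemma kappa_eq: "kappa R = card ((\<lambda>P. unimodular_equivalence `` {P}) ` polygons_in_disc R)"
proof -
  have "{C \<in> {P. convex_lattice_polygon P} // unimodular_equivalence. \<exists>P\<in>C. P \<subseteq> cball 0 R}
      = (\<lambda>P. unimodular_equivalence `` {P}) ` polygons_in_disc R"
  proof (intro equalityI subsetI)
    fix C assume C: "C \<in> {C \<in> {P. convex_lattice_polygon P} // unimodular_equivalence. \<exists>P\<in>C. P \<subseteq> cball 0 R}"
    then obtain P where P: "P \<in> C" "P \<subseteq> cball 0 R" by blast
    have "convex_lattice_polygon P"
      using C P in_quotient_imp_subset[OF equiv_unimodular_equivalence] by blast
    moreover have "C = unimodular_equivalence `` {P}"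
      using C P(1) equiv_class_eq[OF equiv_unimodular_equivalence] by (auto elim!: quotientE)
    ultimately show "C \<in> (\<lambda>P. unimodular_equivalence `` {P}) ` polygons_in_disc R"
      using P(2) unfolding polygons_in_disc_def by blast
  next
    fix C assume "C \<in> (\<lambda>P. unimodular_equivalence `` {P}) ` polygons_in_disc R"
    then obtain P where P: "convex_lattice_polygon P" "P \<subseteq> cball 0 R" "C = unimodular_equivalence `` {P}"
      unfolding polygons_in_disc_def by blast
    moreover have "P \<in> C"
      using P equiv_class_self[OF equiv_unimodular_equivalence] by blast
    ultimately show "C \<in> {C \<in> {P. convex_lattice_polygon P} // unimodular_equivalence. \<exists>P\<in>C. P \<subseteq> cball 0 R}"
      by (auto intro: quotientI)
  qed
  then show ?thesis unfolding kappa_def by simp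
qed

text \<open>An affine map is fixed by its values at three affinely independent lattice points of
  \<open>P\<close>, and these values are lattice points of the disc; hence the exponent
  \<open>3\<close>.\<close>

lemma card_equivalent_polygons_le:
  assumes "P \<in> polygons_in_disc R"
  shows "card {Q \<in> polygons_in_disc R. (P, Q) \<in> unimodular_equivalence} \<le> card (lattice_box \<lfloor>R\<rfloor>) ^ 3"
proof -
  define L where "L = lattice_points \<inter> cball 0 R"
  have L: "L \<subseteq> ivec ` lattice_box \<lfloor>R\<rfloor>"
    unfolding L_def range_ivec[symmetric] using ivec_in_cball_imp_lattice_box by auto
  then have finL: "finite L" by (rule finite_subset) simp
  have cardL: "card L \<le> card (lattice_box \<lfloor>R\<rfloor>)"
    using L by (rule surj_card_le[rotated]) simp
  obtain S where S: "finite S" "S \<subseteq> lattice_points" "P = convex hull S" "aff_dim P = 2"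
    using assms unfolding polygons_in_disc_def convex_lattice_polygon_def by blast
  \<comment> \<open>Choosing the affine basis inside \<open>S\<close> ensures that it consists of
    lattice points of \<open>P\<close>.\<close>
  obtain B where B: "\<not> affine_dependent B" "B \<subseteq> S" "affine hull S = affine hull B"
    using affine_basis_exists by metis
  have "aff_dim B = 2"
    using S(3,4) B(3) by (metis aff_dim_affine_hull aff_dim_convex_hull)
  then have "card B = 3" and full: "affine hull B = UNIV"
    using aff_dim_affine_independent[OF B(1)] aff_dim_eq_full[of B] by auto
  have finB: "finite B" using B(2) S(1) finite_subset by blast
  define X where "X = {Q \<in> polygons_in_disc R. (P, Q) \<in> unimodular_equivalence}"
  have "\<forall>Q\<in>X. \<exists>\<sigma>. unimodular_transformation \<sigma> \<and> \<sigma> ` P = Q"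
    unfolding X_def unimodular_equivalence_def by blast
  then obtain \<sigma> where \<sigma>: "\<And>Q. Q \<in> X \<Longrightarrow> unimodular_transformation (\<sigma> Q)" "\<And>Q. Q \<in> X \<Longrightarrow> \<sigma> Q ` P = Q"
    by metis
  define \<phi> where "\<phi> = (\<lambda>Q. restrict (\<sigma> Q) B)"
  have "inj_on \<phi> X"
  proof
    fix Q Q' assume Q: "Q \<in> X" "Q' \<in> X" "\<phi> Q = \<phi> Q'"
    obtain M v where M: "\<sigma> Q = (\<lambda>x. M *v x + v)"
      using \<sigma>(1)[OF Q(1)] unfolding unimodular_transformation_def by blast
    obtain M' v' where M': "\<sigma> Q' = (\<lambda>x. M' *v x + v')"
      using \<sigma>(1)[OF Q(2)] unfolding unimodular_transformation_def by blast
    \<comment> \<open>Two affine maps agree on an affine set; as it contains the basis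
      \<open>B\<close>, it is the whole plane.\<close>
    define H where "H = {x. \<sigma> Q x = \<sigma> Q' x}"
    have "affine H"
      unfolding affine_def
    proof (intro ballI allI impI)
      fix x y and s t :: real assume xy: "x \<in> H" "y \<in> H" "s + t = 1"
      have aff: "N *v (s *\<^sub>R x + t *\<^sub>R y) + w = s *\<^sub>R (N *v x + w) + t *\<^sub>R (N *v y + w)"
        for N :: "real ^ 2 ^ 2" and w
      proof -
        have "w = s *\<^sub>R w + t *\<^sub>R w" using xy(3) by (simp flip: scaleR_add_left)
        then show ?thesis
          by (simp add: matrix_vector_right_distrib matrix_vector_mult_scaleR scaleR_add_right)
      qed
      show "s *\<^sub>R x + t *\<^sub>R y \<in> H"
        using xy(1,2) unfolding H_def M M' by (simp add: aff)
    qed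
    moreover have "B \<subseteq> H"
      using Q(3) unfolding \<phi>_def H_def by (metis (mono_tags, lifting) mem_Collect_eq restrict_apply' subsetI)
    ultimately have "affine hull B \<subseteq> H" by (rule hull_minimal[rotated])
    then have "\<sigma> Q = \<sigma> Q'" unfolding full H_def by auto
    then show "Q = Q'" using \<sigma>(2) Q by metis
  qed
  moreover have "\<phi> ` X \<subseteq> B \<rightarrow>\<^sub>E L"
  proof clarify
    fix Q assume Q: "Q \<in> X"
    have "\<sigma> Q x \<in> L" if "x \<in> B" for x
    proof -
      obtain M v where M: "unimodular_matrix M" "v \<in> lattice_points" "\<sigma> Q = (\<lambda>x. M *v x + v)"
        using \<sigma>(1)[OF Q] unfolding unimodular_transformation_def by blast
      have "M *v x \<in> lattice_points"
        using lattice_points_matrix[OF M(1)] that B(2) S(2) by blast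
      then have "\<sigma> Q x \<in> lattice_points"
        using M(2,3) by (simp add: lattice_points_def)
      moreover have "x \<in> P" unfolding S(3) using that B(2) by (auto intro: hull_inc)
      then have "\<sigma> Q x \<in> cball 0 R"
        using \<sigma>(2)[OF Q] Q unfolding X_def polygons_in_disc_def by blast
      ultimately show ?thesis unfolding L_def by blast
    qed
    then show "\<phi> Q \<in> B \<rightarrow>\<^sub>E L" unfolding \<phi>_def by auto
  qed
  ultimately have "card X \<le> card (B \<rightarrow>\<^sub>E L)"
    using finL finB by (intro card_inj_on_le) (auto intro!: finite_PiE)
  also have "\<dots> \<le> card (lattice_box \<lfloor>R\<rfloor>) ^ 3"
    using finB cardL \<open>card B = 3\<close> by (simp add: card_funcsetE power_mono)
  finally show ?thesis unfolding X_def .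
qed

text \<open>Group the polygons by class: each group lies among the polygons of the disc equivalent
  to one of its members.\<close>

lemma card_polygons_in_disc_le_kappa:
  "card (polygons_in_disc R) \<le> kappa R * card (lattice_box \<lfloor>R\<rfloor>) ^ 3"
proof -
  define cls where "cls = (\<lambda>P. unimodular_equivalence `` {P})"
  have "polygons_in_disc R = (\<Union>C\<in>cls ` polygons_in_disc R. {Q \<in> polygons_in_disc R. cls Q = C})"
    by blast
  then have "card (polygons_in_disc R) \<le>
      (\<Sum>C\<in>cls ` polygons_in_disc R. card {Q \<in> polygons_in_disc R. cls Q = C})"
    using card_UN_le[of "cls ` polygons_in_disc R" "\<lambda>C. {Q \<in> polygons_in_disc R. cls Q = C}"] by simp
  also have "\<dots> \<le> (\<Sum>C\<in>cls ` polygons_in_disc R. card (lattice_box \<lfloor>R\<rfloor>) ^ 3)"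
  proof (rule sum_mono, clarify)
    fix P assume P: "P \<in> polygons_in_disc R"
    have "{Q \<in> polygons_in_disc R. cls Q = cls P} \<subseteq>
        {Q \<in> polygons_in_disc R. (P, Q) \<in> unimodular_equivalence}"
      using equiv_class_self[OF equiv_unimodular_equivalence]
      unfolding cls_def polygons_in_disc_def by blast
    then have "card {Q \<in> polygons_in_disc R. cls Q = cls P} \<le>
        card {Q \<in> polygons_in_disc R. (P, Q) \<in> unimodular_equivalence}"
      by (intro card_mono) auto
    then show "card {Q \<in> polygons_in_disc R. cls Q = cls P} \<le> card (lattice_box \<lfloor>R\<rfloor>) ^ 3"
      using card_equivalent_polygons_le[OF P] by linarith
  qed
  finally show ?thesis unfolding kappa_eq cls_def by simp
qed

section \<open>The upper bound\<close>

lemma kappa_le: "kappa R \<le> card (polygons_in_disc R)"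
  unfolding kappa_eq by (simp add: card_image_le)

lemma ln_kappa_le:
  assumes "R \<ge> 1"
  shows "ln (real (kappa R)) \<le> 72 * R powr (2 / 3)"
proof (cases "kappa R = 0")
  case False
  define t where "t = R powr (2 / 3)"
  \<comment> \<open>This choice balances \<open>s * R\<close> against \<open>1 / s\<^sup>2\<close>:
    both equal \<open>t\<close>.\<close>
  define s where "s = R powr (- 1 / 3)"
  have s: "s > 0" "s * R = t" "1 / s\<^sup>2 = t"
    using assms powr_add[of R "-1/3" 1] powr_add[of R "1/3" "1/3"]
    unfolding s_def t_def by (simp_all add: power2_eq_square powr_minus_divide)
  have t1: "t \<ge> 1" unfolding t_def using assms by (simp add: ge_one_powr_ge_zero)
  have n: "\<lfloor>R\<rfloor> \<ge> 0" "of_int \<lfloor>R\<rfloor> \<le> R" using assms by auto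
  have "real (card (exposed_sets \<lfloor>R\<rfloor>)) \<le> 1 + (2 * of_int \<lfloor>R\<rfloor> + 1)\<^sup>2 * exp (4 * s * of_int \<lfloor>R\<rfloor> + 1 / s\<^sup>2)"
    using card_exposed_sets_le[OF n(1) s(1)] .
  also have "\<dots> \<le> 1 + (3 * R)\<^sup>2 * exp (5 * t)"
  proof (intro add_left_mono mult_mono power_mono)
    have "4 * (s * of_int \<lfloor>R\<rfloor>) \<le> 4 * (s * R)" using n s(1) by simp
    then show "exp (4 * s * of_int \<lfloor>R\<rfloor> + 1 / s\<^sup>2) \<le> exp (5 * t)" using s by simp
    show "2 * of_int \<lfloor>R\<rfloor> + 1 \<le> 3 * R" using n assms by linarith
  qed (use n assms in auto)
  also have "\<dots> \<le> 10 * R\<^sup>2 * exp (5 * t)"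
  proof -
    have "1 * 1 \<le> R\<^sup>2 * exp (5 * t)" using assms t1 by (intro mult_mono) auto
    then show ?thesis by (simp add: power_mult_distrib)
  qed
  finally have c: "real (card (exposed_sets \<lfloor>R\<rfloor>)) \<le> 10 * R\<^sup>2 * exp (5 * t)" .
  have "real (kappa R) \<le> real (card (exposed_sets \<lfloor>R\<rfloor>)) ^ 4"
    using kappa_le[of R] card_polygons_in_disc_le[of R] by (metis le_trans of_nat_le_iff of_nat_power)
  also have "\<dots> \<le> (10 * R\<^sup>2 * exp (5 * t)) ^ 4"
    using c by (intro power_mono) auto
  finally have "ln (real (kappa R)) \<le> ln ((10 * R\<^sup>2 * exp (5 * t)) ^ 4)"
    using False assms by (subst ln_le_cancel_iff) auto
  also have "\<dots> = 4 * (ln 10 + 2 * ln R + 5 * t)"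
    using assms by (simp add: ln_realpow ln_mult)
  \<comment> \<open>As \<open>t \<ge> 1\<close>, the constant \<open>ln 10\<close> is at most
    \<open>9 * t\<close>; the term in \<open>ln R\<close> is absorbed through
    \<open>2 / 3 * ln R = ln t \<le> t\<close>. The total is \<open>72 * t\<close>.\<close>
  also have "\<dots> \<le> 4 * (9 * t + 4 * t + 5 * t)"
  proof -
    have "ln (10::real) \<le> 9" using ln_le_minus_one[of 10] by simp
    moreover have "2 / 3 * ln R \<le> t"
      using ln_le_minus_one[of t] t1 assms by (simp add: t_def ln_powr)
    ultimately show ?thesis using t1 by simp
  qed
  finally show ?thesis by (simp add: t_def)
\<comment> \<open>The remaining case rests on the convention \<open>ln 0 = 0\<close>.\<close>
qed simp

section \<open>The lower bound\<close>

text \<open>Each point of \<open>V\<close> lies outside the hull of any others, so a subset can be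
  read off from its hull. Three points kept in every subset guarantee dimension two.\<close>

lemma two_power_le_card_polygons_in_disc:
  assumes V: "finite V" "card V \<ge> 3" "ivec ` V \<subseteq> cball 0 R"
    and exposed: "\<And>p. p \<in> V \<Longrightarrow> \<exists>c. \<forall>q\<in>V. q \<noteq> p \<longrightarrow> c \<bullet> ivec q < c \<bullet> ivec p"
  shows "2 ^ (card V - 3) \<le> card (polygons_in_disc R)"
proof -
  have notin: "ivec p \<notin> convex hull (ivec ` T)" if T: "p \<in> V" "T \<subseteq> V" "p \<notin> T" for p T
  proof -
    obtain c where "\<forall>q\<in>V. q \<noteq> p \<longrightarrow> c \<bullet> ivec q < c \<bullet> ivec p" using exposed T by blast
    then show ?thesis using T by (intro exposed_imp_not_in_convex_hull[of _ c]) auto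
  qed
  obtain B where B: "B \<subseteq> V" "card B = 3"
    using obtain_subset_with_card_n[OF V(2)] by blast
  obtain p q r where pqr: "B = {p, q, r}" "p \<noteq> q" "q \<noteq> r" "p \<noteq> r"
    using B(2) unfolding card_3_iff by blast
  \<comment> \<open>Of three collinear points one lies between the other two, contrary to
    exposedness.\<close>
  have "\<not> collinear (ivec ` B)"
  proof
    assume "collinear (ivec ` B)"
    then have "between (ivec q, ivec r) (ivec p) \<or> between (ivec r, ivec p) (ivec q) \<or>
        between (ivec p, ivec q) (ivec r)"
      unfolding pqr(1) using collinear_between_cases by fastforce
    moreover have "\<not> between (ivec y, ivec z) (ivec x)" if "x \<in> V" "y \<in> V" "z \<in> V" "x \<noteq> y" "x \<noteq> z" for x y z
      using notin[of x "{y, z}"] that by (simp add: between_mem_segment segment_convex_hull)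
    ultimately show False using pqr B(1) by auto
  qed
  then have dim: "aff_dim (ivec ` B) \<ge> 2"
    by (simp add: collinear_aff_dim)
  define f where "f = (\<lambda>T. convex hull (ivec ` (B \<union> T)))"
  have "inj_on f (Pow (V - B))"
  proof
    fix T T' assume T: "T \<in> Pow (V - B)" "T' \<in> Pow (V - B)" "f T = f T'"
    have "X \<subseteq> Y" if XY: "X \<subseteq> V - B" "Y \<subseteq> V - B" "f X = f Y" for X Y
    proof
      fix x assume x: "x \<in> X"
      then have "ivec x \<in> f X" unfolding f_def by (simp add: hull_inc)
      then show "x \<in> Y" using notin[of x "B \<union> Y"] XY x B(1) unfolding f_def by auto
    qed
    from this[of T T'] this[of T' T] show "T = T'" using T by auto
  qed
  moreover have "f ` Pow (V - B) \<subseteq> polygons_in_disc R"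
  proof clarify
    fix T assume T: "T \<subseteq> V - B"
    have "B \<union> T \<subseteq> V" using T B by blast
    then have fin: "finite (ivec ` (B \<union> T))" using V(1) finite_subset by blast
    have "ivec ` B \<subseteq> ivec ` (B \<union> T)" by blast
    then have "aff_dim (f T) \<ge> 2"
      using dim aff_dim_subset[of "ivec ` B" "ivec ` (B \<union> T)"]
      unfolding f_def aff_dim_convex_hull by linarith
    moreover have "aff_dim (f T) \<le> 2"
      using aff_dim_le_DIM[of "f T"] by simp
    moreover have "ivec ` (B \<union> T) \<subseteq> lattice_points" using range_ivec by blast
    ultimately have "convex_lattice_polygon (f T)"
      using fin unfolding convex_lattice_polygon_def f_def by auto
    moreover have "f T \<subseteq> cball 0 R"
      unfolding f_def using \<open>B \<union> T \<subseteq> V\<close> V(3) by (intro hull_minimal) auto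
    ultimately show "f T \<in> polygons_in_disc R" unfolding polygons_in_disc_def by blast
  qed
  ultimately have "card (Pow (V - B)) \<le> card (polygons_in_disc R)"
    by (intro card_inj_on_le) auto
  moreover have "card (V - B) = card V - 3"
    using B V(1) by (simp add: card_Diff_subset finite_subset)
  ultimately show ?thesis using V(1) by (simp add: card_Pow)
qed

section \<open>Density of coprime pairs\<close>

definition coprime_pairs :: "nat \<Rightarrow> (nat \<times> nat) set" where
  "coprime_pairs m = {v \<in> {1..m} \<times> {1..m}. coprime (fst v) (snd v)}"

lemma finite_coprime_pairs [simp]: "finite (coprime_pairs m)"
  by (simp add: coprime_pairs_def)

text \<open>Telescoping through \<open>1 / (m + 1)^2 \<le> 1 / m - 1 / (m + 1)\<close>; the
  subtracted \<open>1 / m\<close> carries the induction, and equality holds at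
  \<open>m = 2\<close>.\<close>

lemma sum_inverse_squares_le:
  assumes "m \<ge> 2"
  shows "(\<Sum>d\<in>{2..m}. 1 / real d ^ 2) \<le> 3 / 4 - 1 / real m"
  using assms
proof (induction m rule: dec_induct)
  case (step m)
  have "1 / real (Suc m) ^ 2 \<le> 1 / (real m * real (Suc m))"
    using step.hyps unfolding power2_eq_square by (intro frac_le mult_right_mono) auto
  also have "\<dots> = 1 / real m - 1 / real (Suc m)"
    using step.hyps by (simp add: divide_simps)
  finally have "1 / real (Suc m) ^ 2 \<le> 1 / real m - 1 / real (Suc m)" .
  then show ?case using step by simp
qed (simp add: power2_eq_square)

text \<open>A union bound over common divisors \<open>d \<ge> 2\<close>: at most
  \<open>(m / d)^2\<close> pairs are divisible by \<open>d\<close>, so at most three quarters of the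
  square is lost.\<close>

lemma card_coprime_pairs_ge: "real (card (coprime_pairs m)) \<ge> real m ^ 2 / 4"
proof (cases "m \<ge> 2")
  case True
  define N where "N = {1..m} \<times> {1..m} - coprime_pairs m"
  define g where "g = (\<lambda>d. (\<lambda>v. (d * fst v, d * snd v)) ` ({1..m div d} \<times> {1..m div d}))"
  have "N \<subseteq> (\<Union>d\<in>{2..m}. g d)"
  proof
    fix v assume v: "v \<in> N"
    obtain a b where ab: "v = (a, b)" "1 \<le> a" "a \<le> m" "1 \<le> b" "b \<le> m" "\<not> coprime a b"
      using v unfolding N_def coprime_pairs_def by (cases v) auto
    define d where "d = gcd a b"
    have d: "d \<noteq> 0" "d \<noteq> 1" "d dvd a" "d dvd b"
      using ab unfolding d_def coprime_iff_gcd_eq_1 by auto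
    then have "d \<in> {2..m}" using dvd_imp_le[of d a] ab by auto
    moreover have "v \<in> g d"
      unfolding g_def using ab d
      by (intro image_eqI[of _ _ "(a div d, b div d)"])
         (auto simp: div_le_mono Suc_le_eq div_greater_zero_iff intro: dvd_imp_le)
    ultimately show "v \<in> (\<Union>d\<in>{2..m}. g d)" by blast
  qed
  then have "card N \<le> card (\<Union>d\<in>{2..m}. g d)"
    by (intro card_mono) (auto simp: g_def)
  also have "\<dots> \<le> (\<Sum>d\<in>{2..m}. card (g d))" by (rule card_UN_le) simp
  finally have "real (card N) \<le> (\<Sum>d\<in>{2..m}. real (card (g d)))"
    by (metis of_nat_le_iff of_nat_sum)
  also have "\<dots> \<le> (\<Sum>d\<in>{2..m}. real m ^ 2 * (1 / real d ^ 2))"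
  proof (rule sum_mono)
    fix d assume "d \<in> {2..m}"
    have "card (g d) \<le> (m div d) * (m div d)"
      unfolding g_def
      using card_image_le[of "{1..m div d} \<times> {1..m div d}" "\<lambda>v. (d * fst v, d * snd v)"] by simp
    then have "real (card (g d)) \<le> real (m div d) ^ 2"
      by (simp add: power2_eq_square flip: of_nat_mult)
    also have "\<dots> \<le> (real m / real d) ^ 2"
      by (intro power_mono of_nat_div_le_of_nat) auto
    finally show "real (card (g d)) \<le> real m ^ 2 * (1 / real d ^ 2)"
      by (simp add: power_divide)
  qed
  also have "\<dots> = real m ^ 2 * (\<Sum>d\<in>{2..m}. 1 / real d ^ 2)" by (simp add: sum_distrib_left)
  also have "\<dots> \<le> real m ^ 2 * (3 / 4)"
    using order_trans[OF sum_inverse_squares_le[OF True], of "3 / 4"] by (intro mult_left_mono) auto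
  finally have "real (card N) \<le> real m ^ 2 * (3 / 4)" .
  moreover have "real (card N) = real m ^ 2 - real (card (coprime_pairs m))"
  proof -
    have sub: "coprime_pairs m \<subseteq> {1..m} \<times> {1..m}" by (auto simp: coprime_pairs_def)
    have "card N + card (coprime_pairs m) = m * m"
      unfolding N_def using sub card_mono[OF _ sub] by (simp add: card_Diff_subset)
    then show ?thesis by (simp add: power2_eq_square flip: of_nat_mult)
  qed
  ultimately show ?thesis by simp
next
  case False
  then consider "m = 0" | "m = 1" by linarith
  then show ?thesis
  proof cases
    case 2
    have "coprime_pairs 1 = {(1, 1)}" by (auto simp: coprime_pairs_def)
    then show ?thesis using 2 by simp
  qed simp
qed

section \<open>A strictly convex chain of partial sums\<close>

definition shallower :: "nat \<Rightarrow> nat \<times> nat \<Rightarrow> (nat \<times> nat) set" where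
  "shallower m v = {u \<in> coprime_pairs m. snd u * fst v \<le> snd v * fst u}"

text \<open>A partial sum in order of slope, indexed by the pair at which it stops; this replaces
  sorting. Slopes are compared in \<open>shallower\<close> by cross-multiplication.\<close>

definition chain_vertex :: "nat \<Rightarrow> nat \<times> nat \<Rightarrow> int \<times> int" where
  "chain_vertex m v = (\<Sum>u\<in>shallower m v. int (fst u), \<Sum>u\<in>shallower m v. int (snd u))"

lemma finite_shallower [simp]: "finite (shallower m v)"
  by (simp add: shallower_def)

text \<open>Equal sets force equal slopes, and a coprime pair is determined by its slope.\<close>

lemma shallower_inject:
  assumes "v \<in> coprime_pairs m" "w \<in> coprime_pairs m" "shallower m v = shallower m w"
  shows "v = w"
proof -
  have "v \<in> shallower m w" "w \<in> shallower m v"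
    using assms by (auto simp: shallower_def)
  then have eq: "snd v * fst w = snd w * fst v"
    by (auto simp: shallower_def)
  have cop: "coprime (fst v) (snd v)" "coprime (fst w) (snd w)" "fst v > 0"
    using assms by (auto simp: coprime_pairs_def)
  have "fst v dvd fst w" "fst w dvd fst v"
    using eq cop by (metis coprime_dvd_mult_right_iff dvd_triv_right)+
  then have "fst v = fst w" by (rule dvd_antisym)
  then show ?thesis using eq cop(3) by (auto simp: prod_eq_iff)
qed

text \<open>Passing from \<open>Y\<close> to \<open>X\<close> only removes negative terms and adds
  positive ones, so \<open>X\<close> is the unique maximiser among subset sums.\<close>

lemma sum_less_sum_positive_part:
  fixes g :: "'a \<Rightarrow> real"
  assumes "finite A" "X \<subseteq> A" "Y \<subseteq> A" "Y \<noteq> X"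
    and "\<And>u. u \<in> X \<Longrightarrow> g u > 0" "\<And>u. u \<in> A - X \<Longrightarrow> g u < 0"
  shows "sum g Y < sum g X"
proof -
  have "(\<Sum>u\<in>A. if u \<in> Y then g u else 0) < (\<Sum>u\<in>A. if u \<in> X then g u else 0)"
  proof (rule sum_strict_mono_ex1)
    show "\<forall>u\<in>A. (if u \<in> Y then g u else 0) \<le> (if u \<in> X then g u else 0)"
      using assms(5,6) by (auto intro: less_imp_le)
    show "\<exists>u\<in>A. (if u \<in> Y then g u else 0) < (if u \<in> X then g u else 0)"
      using assms(2-6) by (metis (full_types) DiffI subsetD subsetI subset_antisym)
  qed (fact assms(1))
  then show ?thesis
    using assms(1-3) by (simp add: sum.If_cases Int_absorb1 Int_commute)
qed

text \<open>On chain vertices a linear functional becomes a subset sum over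
  \<open>shallower\<close>. If it is positive on \<open>shallower m v\<close> and negative on the
  other coprime pairs, only \<open>v\<close> attains the maximum.\<close>

lemma chain_vertex_exposed:
  assumes v: "v \<in> coprime_pairs m"
  shows "\<exists>c. \<forall>w\<in>coprime_pairs m. w \<noteq> v \<longrightarrow>
    c \<bullet> ivec (chain_vertex m w) < c \<bullet> ivec (chain_vertex m v)"
proof -
  define a b where "a = real (fst v)" and "b = real (snd v)"
  \<comment> \<open>The functional \<open>(b, -a)\<close> vanishes on the pair \<open>v\<close>, hence ties with the preceding vertex. Adding
    \<open>(a, 0)\<close> breaks the tie, and the factor \<open>2 m\<^sup>2\<close> keeps the values on steeper pairs negative.\<close>
  define c :: "real ^ 2" where
    "c = vector [2 * real m ^ 2 * b + a, - 2 * real m ^ 2 * a]"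
  define g where "g = (\<lambda>u. 2 * real m ^ 2 * (b * real (fst u) - a * real (snd u)) + a * real (fst u))"
  have inner: "c \<bullet> ivec (chain_vertex m w) = sum g (shallower m w)" for w
    unfolding inner_ivec c_def g_def chain_vertex_def
    by (simp add: sum_distrib_left sum.distrib[symmetric] algebra_simps)
  have a: "1 \<le> a" "a \<le> real m" using v by (auto simp: a_def coprime_pairs_def)
  have pos: "g u > 0" if "u \<in> shallower m v" for u
  proof -
    have "snd u * fst v \<le> snd v * fst u" "fst u \<ge> 1"
      using that by (auto simp: shallower_def coprime_pairs_def)
    then have "a * real (snd u) \<le> b * real (fst u)" "real (fst u) \<ge> 1"
      unfolding a_def b_def by (simp_all add: mult_ac flip: of_nat_mult)
    moreover from this have "a * real (fst u) > 0" using a by (intro mult_pos_pos) auto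
    ultimately show ?thesis unfolding g_def by (intro add_nonneg_pos mult_nonneg_nonneg) auto
  qed
  have neg: "g u < 0" if "u \<in> coprime_pairs m - shallower m v" for u
  proof -
    \<comment> \<open>Integrality turns the strict slope comparison into a gap of at least
      \<open>1\<close>, so the main term is at most \<open>- 2 * m^2\<close>, while the perturbation
      is at most \<open>m^2\<close>.\<close>
    have "snd v * fst u + 1 \<le> snd u * fst v" "fst u \<le> m"
      using that by (auto simp: shallower_def coprime_pairs_def)
    then have "b * real (fst u) + 1 \<le> a * real (snd u)" "real (fst u) \<le> real m"
      unfolding a_def b_def by (simp_all add: mult_ac flip: of_nat_mult of_nat_Suc)
    then have "2 * real m ^ 2 * (b * real (fst u) - a * real (snd u)) \<le> 2 * real m ^ 2 * (-1)"
      by (intro mult_left_mono) auto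
    moreover have "a * real (fst u) \<le> real m * real m"
      using a \<open>real (fst u) \<le> real m\<close> by (intro mult_mono) auto
    moreover have "real m ^ 2 > 0" using a by simp
    ultimately show ?thesis unfolding g_def by (simp add: power2_eq_square)
  qed
  show ?thesis
  proof (intro exI ballI impI)
    fix w assume w: "w \<in> coprime_pairs m" "w \<noteq> v"
    show "c \<bullet> ivec (chain_vertex m w) < c \<bullet> ivec (chain_vertex m v)"
      unfolding inner
    proof (rule sum_less_sum_positive_part[of "coprime_pairs m"])
      show "shallower m w \<noteq> shallower m v" using shallower_inject w v by blast
    qed (use pos neg in \<open>auto simp: shallower_def\<close>)
  qed
qed

text \<open>At most \<open>m^2\<close> vectors with entries at most \<open>m\<close> are added, so
  each coordinate is at most \<open>m^3\<close>.\<close>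

lemma chain_vertex_norm:
  "norm (ivec (chain_vertex m v)) \<le> 2 * real m ^ 3"
proof -
  have *: "(\<Sum>u\<in>shallower m v. real (h u)) \<le> real m ^ 3" if "\<And>u. u \<in> shallower m v \<Longrightarrow> h u \<le> m" for h
  proof -
    have "card (shallower m v) \<le> card ({1..m} \<times> {1..m})"
      by (intro card_mono) (auto simp: shallower_def coprime_pairs_def)
    then have c: "real (card (shallower m v)) \<le> real m * real m"
      by (simp flip: of_nat_mult)
    have "(\<Sum>u\<in>shallower m v. real (h u)) \<le> real (card (shallower m v)) * real m"
      using that by (intro sum_bounded_above) auto
    also have "\<dots> \<le> real m * real m * real m" using c by (intro mult_right_mono) auto
    finally show ?thesis by (simp add: power3_eq_cube)
  qed
  have "norm (ivec (chain_vertex m v)) \<le>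
    (\<Sum>u\<in>shallower m v. real (fst u)) + (\<Sum>u\<in>shallower m v. real (snd u))"
    using norm_ivec_le[of "chain_vertex m v"] by (simp add: chain_vertex_def sum_nonneg)
  also have "\<dots> \<le> real m ^ 3 + real m ^ 3"
    by (intro add_mono *) (auto simp: shallower_def coprime_pairs_def)
  finally show ?thesis by simp
qed

text \<open>The exponent \<open>6\<close> reflects three basis points with at most
  \<open>(2 * R + 1)^2\<close> possible images each.\<close>

lemma two_power_le_kappa:
  assumes "2 * real m ^ 3 \<le> R" "real m ^ 2 / 4 \<ge> 3"
  shows "2 powr (real m ^ 2 / 4 - 3) \<le> real (kappa R) * (2 * R + 1) ^ 6"
proof -
  define V where "V = chain_vertex m ` coprime_pairs m"
  \<comment> \<open>Strict exposure already separates the vertices belonging to different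
    pairs.\<close>
  have inj: "inj_on (chain_vertex m) (coprime_pairs m)"
    by (rule inj_onI) (metis chain_vertex_exposed less_irrefl)
  then have card: "real (card V) \<ge> real m ^ 2 / 4"
    unfolding V_def using card_coprime_pairs_ge by (simp add: card_image)
  have V3: "card V \<ge> 3" using card assms(2) by linarith
  have R0: "R \<ge> 0" using assms(1) by (rule order_trans[rotated]) simp
  have "2 powr (real m ^ 2 / 4 - 3) \<le> (2::real) powr (real (card V - 3))"
    using card V3 by (intro powr_mono) (auto simp: of_nat_diff)
  also have "\<dots> = real (2 ^ (card V - 3))" by (simp add: powr_realpow)
  also have "\<dots> \<le> real (card (polygons_in_disc R))"
  proof (intro of_nat_mono two_power_le_card_polygons_in_disc V3)
    show "finite V" by (simp add: V_def)
    show "ivec ` V \<subseteq> cball 0 R"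
      unfolding V_def using order_trans[OF chain_vertex_norm[of m] assms(1)] by auto
    fix p assume "p \<in> V"
    then obtain v where v: "v \<in> coprime_pairs m" "p = chain_vertex m v" unfolding V_def by blast
    obtain c where "\<forall>w\<in>coprime_pairs m. w \<noteq> v \<longrightarrow>
        c \<bullet> ivec (chain_vertex m w) < c \<bullet> ivec (chain_vertex m v)"
      using chain_vertex_exposed[OF v(1)] by blast
    then show "\<exists>c. \<forall>q\<in>V. q \<noteq> p \<longrightarrow> c \<bullet> ivec q < c \<bullet> ivec p"
      unfolding V_def v(2) by (intro exI[of _ c]) auto
  qed
  also have "\<dots> \<le> real (kappa R) * real (card (lattice_box \<lfloor>R\<rfloor>)) ^ 3"
    using card_polygons_in_disc_le_kappa[of R] by (metis of_nat_le_iff of_nat_mult of_nat_power)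
  also have "\<dots> \<le> real (kappa R) * ((2 * R + 1)\<^sup>2) ^ 3"
  proof (intro mult_left_mono power_mono)
    show "real (card (lattice_box \<lfloor>R\<rfloor>)) \<le> (2 * R + 1)\<^sup>2"
      using R0 by (subst card_lattice_box) (auto intro!: power_mono)
  qed auto
  finally show ?thesis by (simp flip: power_mult)
qed

lemma ln_kappa_ge:
  "\<forall>\<^sub>F R in at_top. 1 / 20 * R powr (2 / 3) \<le> ln (real (kappa R))"
proof -
  \<comment> \<open>Here \<open>t\<close> stands for the cube root of \<open>R / 2\<close>, so
    \<open>4 * t ^ 3 + 1\<close> is \<open>2 * R + 1\<close>. The leading coefficient
    \<open>1 / 8\<close> on the right leaves room for \<open>1 / 10\<close>, and
    \<open>t \<ge> 5\<close> secures the three fixed vertices.\<close>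
  have "\<forall>\<^sub>F t :: real in at_top. 1 / 10 * t\<^sup>2 \<le>
      ((t - 1)\<^sup>2 / 4 - 3) * (1 / 2) - 6 * ln (4 * t ^ 3 + 1) \<and> t \<ge> 5"
    by (intro eventually_conj eventually_ge_at_top) real_asymp
  moreover have "filterlim (\<lambda>R :: real. (R / 2) powr (1 / 3)) at_top at_top" by real_asymp
  ultimately have ev: "\<forall>\<^sub>F R :: real in at_top. 1 / 10 * ((R / 2) powr (1 / 3))\<^sup>2 \<le>
      (((R / 2) powr (1 / 3) - 1)\<^sup>2 / 4 - 3) * (1 / 2) - 6 * ln (4 * ((R / 2) powr (1 / 3)) ^ 3 + 1) \<and>
      (R / 2) powr (1 / 3) \<ge> 5"
    by (rule eventually_compose_filterlim)
  show ?thesis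
    using ev eventually_ge_at_top[of 1]
  proof eventually_elim
    case (elim R)
    define t where "t = (R / 2) powr (1 / 3)"
    define m where "m = nat \<lfloor>t\<rfloor>"
    have m: "real m \<le> t" "t - 1 \<le> real m" "t \<ge> 5"
      using elim(1) unfolding m_def t_def[symmetric] by linarith+
    have "t ^ 3 = R / 2"
      using elim(2) unfolding t_def by (simp add: powr_power)
    then have m1: "2 * real m ^ 3 \<le> R"
      using power_mono[OF m(1), of 3] by simp
    have m2: "(t - 1)\<^sup>2 \<le> real m ^ 2" using m by (intro power_mono) auto
    have "(4::real)\<^sup>2 \<le> (t - 1)\<^sup>2" using m by (intro power_mono) auto
    then have t3: "(t - 1)\<^sup>2 / 4 \<ge> 3" by simp
    have *: "2 powr (real m ^ 2 / 4 - 3) \<le> real (kappa R) * (2 * R + 1) ^ 6"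
      using m1 m2 t3 by (intro two_power_le_kappa) auto
    \<comment> \<open>Splitting the logarithm of the product requires a nonzero count, which the
      positive left side of the estimate forces.\<close>
    have "0 < 2 powr (real m ^ 2 / 4 - 3)" by simp
    with * have "real (kappa R) \<noteq> 0" by (metis less_le_not_le mult_zero_left)
    then have kp: "real (kappa R) > 0" by simp
    have "(real m ^ 2 / 4 - 3) * ln 2 = ln (2 powr (real m ^ 2 / 4 - 3))"
      by (simp add: ln_powr)
    also have "\<dots> \<le> ln (real (kappa R) * (2 * R + 1) ^ 6)"
      using * by (intro ln_mono) auto
    also have "\<dots> = ln (real (kappa R)) + 6 * ln (2 * R + 1)"
      using kp elim(2) by (simp add: ln_mult ln_realpow)
    finally have "(real m ^ 2 / 4 - 3) * ln 2 \<le> ln (real (kappa R)) + 6 * ln (2 * R + 1)" .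
    moreover have "((t - 1)\<^sup>2 / 4 - 3) * (1 / 2) \<le> (real m ^ 2 / 4 - 3) * ln 2"
      using m2 t3 ln2_ge_two_thirds by (intro mult_mono) auto
    moreover have "1 / 10 * t\<^sup>2 \<le> ((t - 1)\<^sup>2 / 4 - 3) * (1 / 2) - 6 * ln (2 * R + 1)"
      using elim(1) \<open>t ^ 3 = R / 2\<close> unfolding t_def[symmetric] by simp
    \<comment> \<open>Bounding \<open>2 powr (2 / 3)\<close> by \<open>2\<close> turns the constant
      \<open>1 / 10\<close> into \<open>1 / 20\<close>.\<close>
    moreover have "R powr (2 / 3) \<le> 2 * t\<^sup>2"
    proof -
      have "R powr (2 / 3) = 2 powr (2 / 3) * (R / 2) powr (2 / 3)"
        using elim(2) by (simp flip: powr_mult)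
      also have "(R / 2) powr (2 / 3) = t\<^sup>2"
        using elim(2) unfolding t_def by (simp add: powr_power)
      also have "2 powr (2 / 3) * t\<^sup>2 \<le> 2 powr 1 * t\<^sup>2"
        by (intro mult_right_mono powr_mono) auto
      finally show ?thesis by simp
    qed
    ultimately show ?case by linarith
  qed
qed

theorem theorem2p1:
  shows "\<exists>c\<^sub>1 c\<^sub>2 R\<^sub>0 :: real. c\<^sub>1 > 0 \<and> c\<^sub>2 > 0 \<and> R\<^sub>0 > 0 \<and>
    (\<forall>R \<ge> R\<^sub>0. c\<^sub>1 * R powr (2 / 3) \<le> ln (real (kappa R)) \<and>
               ln (real (kappa R)) \<le> c\<^sub>2 * R powr (2 / 3))"
proof -
  obtain R\<^sub>0 where "\<And>R. R \<ge> R\<^sub>0 \<Longrightarrow> 1 / 20 * R powr (2 / 3) \<le> ln (real (kappa R))"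
    using ln_kappa_ge unfolding eventually_at_top_linorder by blast
  \<comment> \<open>The threshold is raised to at least \<open>1\<close>, where the upper bound
    holds.\<close>
  then show ?thesis
    using ln_kappa_le
    by (intro exI[of _ "1 / 20"] exI[of _ 72] exI[of _ "max 1 R\<^sub>0"]) auto
qed

end
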